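(* Let $n$ be a positive integer. Assume that $u=u(t,x)$ is a solution of $$u_t-u_{txx}+\frac{(n+1)(n+2)}{2}u^nu_x=\frac{n(n-1)}{2}u^{n-2}u_x^3+2n u^{n-1}u_xu_{xx}+u^n u_{xxx}$$ vanishing as $|x|\to\infty$, whose derivatives up to second order are bounded. Then the quantities $$\mathcal{H}_1(t):=\int_{\mathbb{R}} u(t,x)\,dx$$ and $$\mathcal{H}(t):=\int_{\mathbb{R}}\frac{u(t,x)^2+u_x(t,x)^2}{2}\,dx=\frac12\|u(t,\cdot)\|_{H^1(\mathbb{R})}^2$$ are constant. In particular, if $u$ is either non-negative or non-positive, then $\|u(t,\cdot)\|_{L^1(\mathbb{R})}$ is constant.
   Context: Here $u$ is a function of $t$ (time) and $x\in\mathbb{R}$ (space), subscripts denote partial derivatives, and "constant" means independent of $t$. $H^1(\mathbb{R})$ is the usual Sobolev space, with $\|f\|_{H^1(\mathbb{R})}^2=\int_{\mathbb{R}}(f^2+(f')^2)\,dx$. *)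

theory Defs
  imports "HOL-Analysis.Analysis"
begin

text \<open>
  A function \<open>u\<close> of time and space is a curried function \<open>u t x\<close>. It is considered for \<open>t\<close> in
  a time interval \<open>T\<close>, which may be open, closed, half-open, bounded or unbounded; at endpoints
  belonging to \<open>T\<close> the time derivative is one-sided. Subscripts are applied from left to right:
  \<open>u_txx\<close> is \<open>Dx (Dx (Dt T u))\<close>.
\<close>

definition Dx :: "(real \<Rightarrow> real \<Rightarrow> real) \<Rightarrow> real \<Rightarrow> real \<Rightarrow> real" where
  "Dx u t x = deriv (u t) x"

definition Dt :: "real set \<Rightarrow> (real \<Rightarrow> real \<Rightarrow> real) \<Rightarrow> real \<Rightarrow> real \<Rightarrow> real" where
  "Dt T u t x = vector_derivative (\<lambda>\<tau>. u \<tau> x) (at t within T)"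

definition has_Dx :: "real set \<Rightarrow> (real \<Rightarrow> real \<Rightarrow> real) \<Rightarrow> bool" where
  "has_Dx T u \<longleftrightarrow> (\<forall>t\<in>T. \<forall>x. u t field_differentiable at x)"

definition has_Dt :: "real set \<Rightarrow> (real \<Rightarrow> real \<Rightarrow> real) \<Rightarrow> bool" where
  "has_Dt T u \<longleftrightarrow> (\<forall>t\<in>T. \<forall>x. (\<lambda>\<tau>. u \<tau> x) differentiable (at t within T))"

definition jointly_continuous :: "real set \<Rightarrow> (real \<Rightarrow> real \<Rightarrow> real) \<Rightarrow> bool" where
  "jointly_continuous T f \<longleftrightarrow> continuous_on (T \<times> UNIV) (\<lambda>(t, x). f t x)"

text \<open>
  Classical regularity: all derivatives through which the equation is formed
  exist and are continuous in \<open>(t, x)\<close>.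
\<close>

definition regular :: "real set \<Rightarrow> (real \<Rightarrow> real \<Rightarrow> real) \<Rightarrow> bool" where
  "regular T u \<longleftrightarrow>
     has_Dx T u \<and> has_Dx T (Dx u) \<and> has_Dx T (Dx (Dx u)) \<and>
     has_Dt T u \<and> has_Dx T (Dt T u) \<and> has_Dx T (Dx (Dt T u)) \<and>
     (\<forall>f \<in> {u, Dx u, Dx (Dx u), Dx (Dx (Dx u)), Dt T u, Dx (Dt T u), Dx (Dx (Dt T u))}.
        jointly_continuous T f)"

text \<open>
  The exponents \<open>n - 1\<close> and \<open>n - 2\<close> are truncated natural number subtractions. For \<open>n \<ge> 1\<close>
  truncation only happens in \<open>n - 2\<close> for \<open>n = 1\<close>, where the coefficient \<open>n (n - 1) / 2\<close>
  of that term is zero.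
\<close>

definition solution :: "nat \<Rightarrow> real set \<Rightarrow> (real \<Rightarrow> real \<Rightarrow> real) \<Rightarrow> bool" where
  "solution n T u \<longleftrightarrow> regular T u \<and>
     (\<forall>t\<in>T. \<forall>x.
        Dt T u t x - Dx (Dx (Dt T u)) t x
          + (real n + 1) * (real n + 2) / 2 * u t x ^ n * Dx u t x
        = real n * (real n - 1) / 2 * u t x ^ (n - 2) * Dx u t x ^ 3
          + 2 * real n * u t x ^ (n - 1) * Dx u t x * Dx (Dx u) t x
          + u t x ^ n * Dx (Dx (Dx u)) t x)"

definition bounded_fun :: "real set \<Rightarrow> (real \<Rightarrow> real \<Rightarrow> real) \<Rightarrow> bool" where
  "bounded_fun T f \<longleftrightarrow> bounded ((\<lambda>(t, x). f t x) ` (T \<times> UNIV))"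

text \<open>
  Integrals are the library's gauge integrals over the real line. They agree with Lebesgue
  integrals for Lebesgue integrable functions and for functions of constant sign, and they
  also cover convergent improper integrals, hence \<open>mass\<close> makes sense without assuming
  absolute integrability.
\<close>

definition mass :: "(real \<Rightarrow> real \<Rightarrow> real) \<Rightarrow> real \<Rightarrow> real" where
  "mass u t = integral UNIV (\<lambda>x. u t x)"

definition energy_density :: "(real \<Rightarrow> real \<Rightarrow> real) \<Rightarrow> real \<Rightarrow> real \<Rightarrow> real" where
  "energy_density u t x = ((u t x)\<^sup>2 + (Dx u t x)\<^sup>2) / 2"

definition energy :: "(real \<Rightarrow> real \<Rightarrow> real) \<Rightarrow> real \<Rightarrow> real" where
  "energy u t = integral UNIV (\<lambda>x. energy_density u t x)"

text \<open>The norm is only used for differentiable functions, whose weak derivative is \<open>deriv f\<close>.\<close>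

definition H1_norm :: "(real \<Rightarrow> real) \<Rightarrow> real" where
  "H1_norm f = sqrt (integral UNIV (\<lambda>x. (f x)\<^sup>2 + (deriv f x)\<^sup>2))"

definition L1_norm :: "(real \<Rightarrow> real) \<Rightarrow> real" where
  "L1_norm f = integral UNIV (\<lambda>x. \<bar>f x\<bar>)"

end

theory Submission
  imports Defs
begin

text \<open>
  Writing \<open>F\<close> for \<open>- (n + 2) / 2 u\<^sup>n\<^sup>+\<^sup>1 + u\<^sup>n u_xx + n / 2 u\<^sup>n\<^sup>-\<^sup>1 u_x\<^sup>2\<close>, the equation reads
  \<open>u_t = (u_tx + F)_x\<close>, and multiplying it by \<open>u\<close> gives
  \<open>((u\<^sup>2 + u_x\<^sup>2) / 2)_t = (u u_tx - (n + 1) / 2 u\<^sup>n\<^sup>+\<^sup>2 + u\<^sup>n\<^sup>+\<^sup>1 u_xx + (n - 1) / 2 u\<^sup>n u_x\<^sup>2)_x\<close>.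
  Integrating over \<open>[s, t] \<times> [a, b]\<close>, it remains to see that the time integrals of both fluxes
  vanish as \<open>\<bar>x\<bar> \<rightarrow> \<infinity>\<close>. By dominated convergence this holds for every bounded term that
  vanishes at infinity for each fixed time. The bounded term \<open>u_tx\<close> of the first flux is not known
  to vanish at infinity, but its time integral is \<open>u_x(t, x) - u_x(s, x)\<close>, and \<open>u_x\<close>
  vanishes at infinity because \<open>u\<close> does and \<open>u_xx\<close> is bounded.
\<close>

section \<open>Limits at infinity and conservation laws\<close>

text \<open>Dominated convergence speaks of sequences, so limits at infinity are reduced to them. On
  the reals \<open>at_infinity\<close> is the supremum of \<open>at_top\<close> and
  \<open>at_bot\<close>, and the second is reflected onto the first.\<close>

lemma tendsto_at_infinityI_sequentially:
  fixes f :: "real \<Rightarrow> 'a::first_countable_topology"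
  assumes "\<And>X. filterlim X at_infinity sequentially \<Longrightarrow> (\<lambda>k. f (X k)) \<longlonglongrightarrow> l"
  shows "(f \<longlongrightarrow> l) at_infinity"
proof -
  have "(f \<longlongrightarrow> l) at_top"
    by (rule tendsto_at_topI_sequentially)
      (use assms at_top_le_at_infinity filterlim_mono in blast)
  moreover have "((\<lambda>x. f (- x)) \<longlongrightarrow> l) at_top"
  proof (rule tendsto_at_topI_sequentially)
    fix X :: "nat \<Rightarrow> real"
    assume "filterlim X at_top sequentially"
    then have "filterlim (\<lambda>k. - X k) at_bot sequentially"
      by (simp add: filterlim_uminus_at_bot)
    then show "(\<lambda>k. f (- X k)) \<longlonglongrightarrow> l"
      using assms at_bot_le_at_infinity filterlim_mono by blast
  qed
  ultimately show ?thesis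
    by (simp add: at_infinity_eq_at_top_bot filterlim_sup filterlim_at_bot_mirror)
qed

lemma tendsto_shift_at_infinity:
  fixes f :: "real \<Rightarrow> 'a::topological_space" and h :: real
  assumes "(f \<longlongrightarrow> l) at_infinity"
  shows "((\<lambda>x. f (x + h)) \<longlongrightarrow> l) at_infinity"
  using tendsto_add_filterlim_at_infinity'[OF filterlim_ident tendsto_const]
    filterlim_compose[OF assms] by blast

text \<open>The difference quotient of \<open>f\<close> over a fixed step \<open>h\<close> tends to
  0 and equals \<open>f'\<close> at a point within distance \<open>h\<close> of \<open>x\<close>. As
  \<open>f''\<close> is bounded by \<open>M\<close>, passing from that point to \<open>x\<close>
  costs at most \<open>M * h\<close>.\<close>

lemma deriv_tendsto_0_at_infinity:
  fixes f :: "real \<Rightarrow> real"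
  assumes f': "\<And>x. (f has_real_derivative f' x) (at x)"
    and f'': "\<And>x. (f' has_real_derivative f'' x) (at x)"
    and bd: "\<And>x. \<bar>f'' x\<bar> \<le> M"
    and lim: "(f \<longlongrightarrow> 0) at_infinity"
  shows "(f' \<longlongrightarrow> 0) at_infinity"
proof (rule tendstoI)
  fix e :: real
  assume e: "e > 0"
  have M: "M \<ge> 0"
    using bd[of 0] by linarith
  \<comment> \<open>Chosen so that \<open>M * h \<le> e / 2\<close>; the summand 1 keeps the
    denominator positive when \<open>M = 0\<close>.\<close>
  define h where "h = e / (2 * (M + 1))"
  have h: "h > 0"
    using e M by (simp add: h_def)
  have "M * h \<le> (M + 1) * h"
    using h by (simp add: mult_right_mono)
  also have "\<dots> = e / 2"
    using M by (simp add: h_def field_simps)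
  finally have Mh: "M * h \<le> e / 2" .
  have "((\<lambda>x. (f (x + h) - f x) / h) \<longlongrightarrow> (0 - 0) / h) at_infinity"
    using h by (intro tendsto_intros tendsto_shift_at_infinity lim) auto
  then have "eventually (\<lambda>x. dist ((f (x + h) - f x) / h) 0 < e / 2) at_infinity"
    using e by (intro tendstoD) auto
  then show "eventually (\<lambda>x. dist (f' x) 0 < e) at_infinity"
  proof eventually_elim
    case (elim x)
    obtain z where z: "x < z" "z < x + h" "f (x + h) - f x = (x + h - x) * f' z"
      using MVT2[of x "x + h" f f'] f' h by auto
    obtain y where y: "f' z - f' x = (z - x) * f'' y"
      using MVT2[of x z f' f''] f'' z by auto
    have "\<bar>f' z - f' x\<bar> = (z - x) * \<bar>f'' y\<bar>"
      using y z by (simp add: abs_mult)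
    also have "\<dots> \<le> h * M"
      using z bd[of y] h by (intro mult_mono) auto
    finally have "\<bar>f' z - f' x\<bar> \<le> e / 2"
      using Mh by (simp add: mult.commute)
    moreover have "\<bar>f' z\<bar> < e / 2"
      using elim z h by simp
    ultimately have "\<bar>f' x\<bar> < e"
      by linarith
    then show ?case
      by simp
  qed
qed

lemma continuous_on_section:
  fixes g :: "'a::topological_space \<Rightarrow> 'b::topological_space \<Rightarrow> 'c::topological_space"
  assumes "continuous_on (A \<times> UNIV) (\<lambda>(a, x). g a x)"
  shows "continuous_on A (\<lambda>a. g a x)"
proof -
  have "continuous_on A (\<lambda>a. case (a, x) of (a, x) \<Rightarrow> g a x)"
    by (rule continuous_on_compose2[OF assms]) (auto intro!: continuous_intros)
  then show ?thesis
    by simp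
qed

lemma integral_tendsto_0_at_infinity:
  fixes g :: "real \<Rightarrow> real \<Rightarrow> real"
  assumes cont: "continuous_on ({s..t} \<times> UNIV) (\<lambda>(\<tau>, x). g \<tau> x)"
    and bd: "\<And>\<tau> x. \<tau> \<in> {s..t} \<Longrightarrow> \<bar>g \<tau> x\<bar> \<le> C"
    and lim: "\<And>\<tau>. \<tau> \<in> {s..t} \<Longrightarrow> (g \<tau> \<longlongrightarrow> 0) at_infinity"
  shows "((\<lambda>x. integral {s..t} (\<lambda>\<tau>. g \<tau> x)) \<longlongrightarrow> 0) at_infinity"
proof (rule tendsto_at_infinityI_sequentially)
  fix X :: "nat \<Rightarrow> real"
  assume X: "filterlim X at_infinity sequentially"
  have "(\<lambda>k. integral {s..t} (\<lambda>\<tau>. g \<tau> (X k))) \<longlonglongrightarrow> integral {s..t} (\<lambda>\<tau>. 0)"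
  proof (rule dominated_convergence(2))
    \<comment> \<open>The time interval is compact, so a constant serves as integrable
      majorant.\<close>
    show "(\<lambda>\<tau>. C) integrable_on {s..t}"
      by (rule integrable_const_ivl)
    show "(\<lambda>\<tau>. g \<tau> (X k)) integrable_on {s..t}" for k
      by (intro integrable_continuous_real continuous_on_section[OF cont])
    show "(\<lambda>k. g \<tau> (X k)) \<longlonglongrightarrow> 0" if "\<tau> \<in> {s..t}" for \<tau>
      using filterlim_compose[OF lim[OF that] X] .
  qed (use bd in auto)
  then show "(\<lambda>k. integral {s..t} (\<lambda>\<tau>. g \<tau> (X k))) \<longlonglongrightarrow> 0"
    by simp
qed

text \<open>Fubini on a box, with \<open>D\<close> continuous, turns the integral of
  \<open>f t - f s\<close> over \<open>[a, b]\<close> into the time integral of \<open>g\<close> at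
  \<open>b\<close> minus that at \<open>a\<close>. The limit is demanded of the time integral of
  \<open>g\<close>, which admits fluxes whose decay at fixed times is unknown. The difference is
  integrated over the line as an improper integral, whether or not \<open>f s\<close> and
  \<open>f t\<close> are integrable separately.\<close>

lemma conservation_law:
  fixes f g D :: "real \<Rightarrow> real \<Rightarrow> real"
  assumes st: "s \<le> t"
    and f: "\<And>\<tau> x. \<tau> \<in> {s..t} \<Longrightarrow>
      ((\<lambda>\<sigma>. f \<sigma> x) has_vector_derivative D \<tau> x) (at \<tau> within {s..t})"
    and g: "\<And>\<tau> x. \<tau> \<in> {s..t} \<Longrightarrow> (g \<tau> has_real_derivative D \<tau> x) (at x)"
    and D: "continuous_on ({s..t} \<times> UNIV) (\<lambda>(\<tau>, x). D \<tau> x)"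
    and g_int: "\<And>x. (\<lambda>\<tau>. g \<tau> x) integrable_on {s..t}"
    and lim: "((\<lambda>x. integral {s..t} (\<lambda>\<tau>. g \<tau> x)) \<longlongrightarrow> 0) at_infinity"
  shows "((\<lambda>x. f t x - f s x) has_integral 0) UNIV"
proof -
  have D_box: "continuous_on (cbox (s, a) (t, b)) (\<lambda>(\<tau>, x). D \<tau> x)" for a b
    by (rule continuous_on_subset[OF D]) (auto simp: cbox_Pair_eq)
  have diff: "f t x - f s x = integral {s..t} (\<lambda>\<tau>. D \<tau> x)" for x
    by (rule integral_unique[OF fundamental_theorem_of_calculus[OF st f], symmetric])
  have integrable: "(\<lambda>x. f t x - f s x) integrable_on cbox a b" for a b
    using integral_integrable_2dim[OF swap_continuous[OF D_box]]
    by (simp add: diff)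
  have int: "integral (cbox a b) (\<lambda>x. f t x - f s x) =
      integral {s..t} (\<lambda>\<tau>. g \<tau> b) - integral {s..t} (\<lambda>\<tau>. g \<tau> a)" if "a \<le> b" for a b
  proof -
    have "integral (cbox a b) (\<lambda>x. f t x - f s x) =
        integral {s..t} (\<lambda>\<tau>. integral {a..b} (D \<tau>))"
      using integral_swap_continuous[OF D_box, of a b] by (simp add: diff)
    also have "\<dots> = integral {s..t} (\<lambda>\<tau>. g \<tau> b - g \<tau> a)"
    proof (rule integral_cong)
      fix \<tau>
      assume \<tau>: "\<tau> \<in> {s..t}"
      have "(g \<tau> has_vector_derivative D \<tau> x) (at x within {a..b})" for x
        unfolding has_real_derivative_iff_has_vector_derivative[symmetric]
        by (rule has_field_derivative_at_within[OF g[OF \<tau>]])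
      then show "integral {a..b} (D \<tau>) = g \<tau> b - g \<tau> a"
        by (rule integral_unique[OF fundamental_theorem_of_calculus[OF that]])
    qed
    also have "\<dots> = integral {s..t} (\<lambda>\<tau>. g \<tau> b) - integral {s..t} (\<lambda>\<tau>. g \<tau> a)"
      by (intro integral_diff g_int)
    finally show ?thesis .
  qed
  have "\<exists>B>0. \<forall>a b. ball 0 B \<subseteq> cbox a b \<longrightarrow>
      norm (integral (cbox a b) (\<lambda>x. f t x - f s x) - 0) < e" if "e > 0" for e
  proof -
    have "eventually (\<lambda>x. dist (integral {s..t} (\<lambda>\<tau>. g \<tau> x)) 0 < e / 2) at_infinity"
      by (rule tendstoD[OF lim]) (use that in simp)
    then obtain B where B: "B > 0"
      "\<And>x. B \<le> \<bar>x\<bar> \<Longrightarrow> \<bar>integral {s..t} (\<lambda>\<tau>. g \<tau> x)\<bar> < e / 2"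
      by (auto simp: eventually_at_infinity_pos)
    show ?thesis
    proof (intro exI[of _ B] conjI allI impI)
      fix a b :: real
      assume "ball 0 B \<subseteq> cbox a b"
      \<comment> \<open>The box is closed, so it contains the closure of the ball and with it the
        points \<open>- B\<close> and \<open>B\<close>, from which on the flux is small.\<close>
      then have "cball 0 B \<subseteq> cbox a b"
        using B closure_minimal[of "ball 0 B" "cbox a b"] by simp
      then have "- B \<in> cbox a b" "B \<in> cbox a b"
        using B by (auto simp: subset_iff)
      then have ab: "a \<le> - B" "B \<le> b" "a \<le> b"
        by auto
      have "\<bar>integral {s..t} (\<lambda>\<tau>. g \<tau> a)\<bar> < e / 2" "\<bar>integral {s..t} (\<lambda>\<tau>. g \<tau> b)\<bar> < e / 2"
        using ab B by (auto intro!: B(2))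
      then show "norm (integral (cbox a b) (\<lambda>x. f t x - f s x) - 0) < e"
        unfolding int[OF \<open>a \<le> b\<close>] real_norm_def by linarith
    qed (use B in auto)
  qed
  with integrable show ?thesis
    by (subst has_integral_alt') auto
qed

text \<open>Integrating \<open>u\<^sub>t\<close> in time and differentiating under the integral sign
  in \<open>x\<close> writes \<open>u\<^sub>x\<close> as its value at \<open>s\<close> plus a time
  integral of \<open>u\<^sub>t\<^sub>x\<close>, which is then differentiated in time. Thus the mixed
  derivative, given in the order time before space, is also available in the other order.\<close>

lemma mixed_derivative:
  fixes u u\<^sub>x u\<^sub>t u\<^sub>t\<^sub>x :: "real \<Rightarrow> real \<Rightarrow> real"
  assumes ux: "\<And>\<tau> x. \<tau> \<in> {s..t} \<Longrightarrow> (u \<tau> has_real_derivative u\<^sub>x \<tau> x) (at x)"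
    and ut: "\<And>\<tau> x. \<tau> \<in> {s..t} \<Longrightarrow>
      ((\<lambda>\<sigma>. u \<sigma> x) has_vector_derivative u\<^sub>t \<tau> x) (at \<tau> within {s..t})"
    and utx: "\<And>\<tau> x. \<tau> \<in> {s..t} \<Longrightarrow> (u\<^sub>t \<tau> has_real_derivative u\<^sub>t\<^sub>x \<tau> x) (at x)"
    and ut_cont: "continuous_on ({s..t} \<times> UNIV) (\<lambda>(\<tau>, x). u\<^sub>t \<tau> x)"
    and utx_cont: "continuous_on ({s..t} \<times> UNIV) (\<lambda>(\<tau>, x). u\<^sub>t\<^sub>x \<tau> x)"
    and \<tau>: "\<tau> \<in> {s..t}"
  shows "((\<lambda>\<sigma>. u\<^sub>x \<sigma> x) has_vector_derivative u\<^sub>t\<^sub>x \<tau> x) (at \<tau> within {s..t})"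
proof -
  have eq: "u\<^sub>x \<sigma> x = u\<^sub>x s x + integral {s..\<sigma>} (\<lambda>\<rho>. u\<^sub>t\<^sub>x \<rho> x)" if \<sigma>: "\<sigma> \<in> {s..t}" for \<sigma>
  proof -
    have sub: "{s..\<sigma>} \<subseteq> {s..t}"
      using \<sigma> by auto
    have u_eq: "u \<sigma> y - u s y = integral {s..\<sigma>} (\<lambda>\<rho>. u\<^sub>t \<rho> y)" for y
      using fundamental_theorem_of_calculus[of s \<sigma> "\<lambda>\<rho>. u \<rho> y" "\<lambda>\<rho>. u\<^sub>t \<rho> y"]
        has_vector_derivative_within_subset[OF ut sub] \<sigma> sub
      by (metis atLeastAtMost_iff integral_unique subsetD)
    have "((\<lambda>y. integral (cbox s \<sigma>) (\<lambda>\<rho>. u\<^sub>t \<rho> y)) has_real_derivative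
        integral (cbox s \<sigma>) (\<lambda>\<rho>. u\<^sub>t\<^sub>x \<rho> x)) (at x within UNIV)"
    proof (rule leibniz_rule_field_derivative)
      show "(\<lambda>\<rho>. u\<^sub>t \<rho> y) integrable_on cbox s \<sigma>" for y
        using continuous_on_subset[OF continuous_on_section[OF ut_cont] sub]
        by (simp add: integrable_continuous_real)
      show "continuous_on (UNIV \<times> cbox s \<sigma>) (\<lambda>(y, \<rho>). u\<^sub>t\<^sub>x \<rho> y)"
        using sub unfolding split_def
        by (intro continuous_on_compose2[OF utx_cont[unfolded split_def],
              where f = "\<lambda>z. (snd z, fst z)", simplified] continuous_intros) auto
    qed (use utx sub in auto)
    \<comment> \<open>By \<open>u_eq\<close> this is the function just differentiated under the
      integral sign, so its two derivatives at \<open>x\<close> coincide.\<close>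
    moreover have "((\<lambda>y. u \<sigma> y - u s y) has_real_derivative u\<^sub>x \<sigma> x - u\<^sub>x s x) (at x)"
      using ux \<sigma> by (intro DERIV_diff) auto
    ultimately show ?thesis
      using DERIV_unique by (fastforce simp: u_eq)
  qed
  have "((\<lambda>\<sigma>. u\<^sub>x s x + integral {s..\<sigma>} (\<lambda>\<rho>. u\<^sub>t\<^sub>x \<rho> x)) has_vector_derivative u\<^sub>t\<^sub>x \<tau> x)
      (at \<tau> within {s..t})"
    using integral_has_vector_derivative[OF continuous_on_section[OF utx_cont] \<tau>]
    by (subst add.commute) (simp add: has_vector_derivative_add_const)
  then show ?thesis
    by (rule has_vector_derivative_transform[OF \<tau> eq, rotated])
qed

text \<open>Adding a difference with integral 0 carries an integral from one time to any other.
  Integrability therefore holds at all times or at none; in the latter case all integrals take the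
  default value 0 and are still constant.\<close>

lemma integral_constant_on:
  fixes f :: "real \<Rightarrow> real \<Rightarrow> real"
  assumes diff: "\<And>s t. s \<in> T \<Longrightarrow> t \<in> T \<Longrightarrow> s \<le> t \<Longrightarrow>
      ((\<lambda>x. f t x - f s x) has_integral 0) UNIV"
  shows "(\<lambda>t. f t integrable_on UNIV) constant_on T"
    and "(\<lambda>t. integral UNIV (f t)) constant_on T"
proof -
  have diff': "((\<lambda>x. f t x - f s x) has_integral 0) UNIV" if "s \<in> T" "t \<in> T" for s t
    using diff[of s t] diff[of t s] has_integral_neg[of "\<lambda>x. f s x - f t x" 0 UNIV] that
    by (cases "s \<le> t") auto
  have transfer: "(f t has_integral i) UNIV" if "s \<in> T" "t \<in> T" "(f s has_integral i) UNIV" for s t i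
    using has_integral_add[OF that(3) diff'[OF that(1,2)]] by simp
  then have integrable: "f s integrable_on UNIV \<longleftrightarrow> f t integrable_on UNIV" if "s \<in> T" "t \<in> T" for s t
    using that unfolding integrable_on_def by blast
  then show "(\<lambda>t. f t integrable_on UNIV) constant_on T"
    unfolding constant_on_def by metis
  have "integral UNIV (f s) = integral UNIV (f t)" if "s \<in> T" "t \<in> T" for s t
    using that transfer[of s t] integrable[of s t]
    by (metis has_integral_integral integral_unique not_integrable_integral)
  then show "(\<lambda>t. integral UNIV (f t)) constant_on T"
    unfolding constant_on_def by metis
qed

section \<open>Decaying solutions on a compact time interval\<close>

lemma mult_bounded_tendsto_0:
  fixes f g :: "'a \<Rightarrow> real"
  assumes "(f \<longlongrightarrow> 0) F" "\<And>x. \<bar>g x\<bar> \<le> C"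
  shows "((\<lambda>x. f x * g x) \<longlongrightarrow> 0) F"
proof (rule Lim_null_comparison)
  show "eventually (\<lambda>x. norm (f x * g x) \<le> \<bar>f x\<bar> * C) F"
    using assms(2) by (simp add: abs_mult mult_left_mono)
  show "((\<lambda>x. \<bar>f x\<bar> * C) \<longlongrightarrow> 0) F"
    using tendsto_mult[OF tendsto_rabs_zero[OF assms(1)] tendsto_const[of C]] by simp
qed

section \<open>Algebra of bounded functions\<close>

lemma bounded_fun_iff: "bounded_fun T f \<longleftrightarrow> (\<exists>C. \<forall>t\<in>T. \<forall>x. \<bar>f t x\<bar> \<le> C)"
  unfolding bounded_fun_def bounded_iff by auto

lemma bounded_funE:
  assumes "bounded_fun T f"
  obtains C where "\<And>t x. t \<in> T \<Longrightarrow> \<bar>f t x\<bar> \<le> C"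
  using assms unfolding bounded_fun_iff by blast

lemma bounded_fun_const: "bounded_fun T (\<lambda>t x. c)"
  unfolding bounded_fun_iff by blast

lemma bounded_fun_add:
  assumes "bounded_fun T f" "bounded_fun T g"
  shows "bounded_fun T (\<lambda>t x. f t x + g t x)"
proof -
  obtain C D where "\<And>t x. t \<in> T \<Longrightarrow> \<bar>f t x\<bar> \<le> C" "\<And>t x. t \<in> T \<Longrightarrow> \<bar>g t x\<bar> \<le> D"
    using assms by (auto elim!: bounded_funE)
  then have "\<bar>f t x + g t x\<bar> \<le> C + D" if "t \<in> T" for t x
    using that by (meson abs_triangle_ineq add_mono order_trans)
  then show ?thesis
    unfolding bounded_fun_iff by blast
qed

lemma bounded_fun_mult:
  assumes "bounded_fun T f" "bounded_fun T g"
  shows "bounded_fun T (\<lambda>t x. f t x * g t x)"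
proof -
  obtain C D where "\<And>t x. t \<in> T \<Longrightarrow> \<bar>f t x\<bar> \<le> C" "\<And>t x. t \<in> T \<Longrightarrow> \<bar>g t x\<bar> \<le> D"
    using assms by (auto elim!: bounded_funE)
  then have "\<bar>f t x * g t x\<bar> \<le> C * D" if "t \<in> T" for t x
    using that unfolding abs_mult by (intro mult_mono) (auto intro: order_trans[OF abs_ge_zero])
  then show ?thesis
    unfolding bounded_fun_iff by blast
qed

lemma bounded_fun_diff:
  assumes "bounded_fun T f" "bounded_fun T g"
  shows "bounded_fun T (\<lambda>t x. f t x - g t x)"
  using bounded_fun_add[OF assms(1) bounded_fun_mult[OF bounded_fun_const[of T "-1"] assms(2)]]
  by simp

lemma bounded_fun_power:
  assumes "bounded_fun T f"
  shows "bounded_fun T (\<lambda>t x. f t x ^ k)"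
  by (induction k) (simp_all add: bounded_fun_const bounded_fun_mult[OF assms])

lemmas bounded_fun_intros =
  bounded_fun_const bounded_fun_add bounded_fun_diff bounded_fun_mult bounded_fun_power

text \<open>The derivatives are parameters tied to \<open>u\<close> by derivative facts, which keeps
  the calculus free of the operators \<open>Dx\<close> and \<open>Dt\<close>. On the compact time
  interval a bound for \<open>u\<close> itself follows from the other assumptions; see
  \<open>u_bd\<close>.\<close>

locale decaying_solution =
  fixes n :: nat and s t :: real and u u\<^sub>x u\<^sub>x\<^sub>x u\<^sub>x\<^sub>x\<^sub>x u\<^sub>t u\<^sub>t\<^sub>x u\<^sub>t\<^sub>x\<^sub>x :: "real \<Rightarrow> real \<Rightarrow> real"
  assumes n: "n \<ge> 1" and st: "s \<le> t"
    and ux: "\<And>\<tau> x. \<tau> \<in> {s..t} \<Longrightarrow> (u \<tau> has_real_derivative u\<^sub>x \<tau> x) (at x)"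
    and uxx: "\<And>\<tau> x. \<tau> \<in> {s..t} \<Longrightarrow> (u\<^sub>x \<tau> has_real_derivative u\<^sub>x\<^sub>x \<tau> x) (at x)"
    and uxxx: "\<And>\<tau> x. \<tau> \<in> {s..t} \<Longrightarrow> (u\<^sub>x\<^sub>x \<tau> has_real_derivative u\<^sub>x\<^sub>x\<^sub>x \<tau> x) (at x)"
    and ut: "\<And>\<tau> x. \<tau> \<in> {s..t} \<Longrightarrow>
      ((\<lambda>\<sigma>. u \<sigma> x) has_vector_derivative u\<^sub>t \<tau> x) (at \<tau> within {s..t})"
    and utx: "\<And>\<tau> x. \<tau> \<in> {s..t} \<Longrightarrow> (u\<^sub>t \<tau> has_real_derivative u\<^sub>t\<^sub>x \<tau> x) (at x)"
    and utxx: "\<And>\<tau> x. \<tau> \<in> {s..t} \<Longrightarrow> (u\<^sub>t\<^sub>x \<tau> has_real_derivative u\<^sub>t\<^sub>x\<^sub>x \<tau> x) (at x)"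
    and u_cont: "jointly_continuous {s..t} u"
    and ux_cont: "jointly_continuous {s..t} u\<^sub>x"
    and uxx_cont: "jointly_continuous {s..t} u\<^sub>x\<^sub>x"
    and ut_cont: "jointly_continuous {s..t} u\<^sub>t"
    and utx_cont: "jointly_continuous {s..t} u\<^sub>t\<^sub>x"
    and pde: "\<And>\<tau> x. \<tau> \<in> {s..t} \<Longrightarrow>
      u\<^sub>t \<tau> x - u\<^sub>t\<^sub>x\<^sub>x \<tau> x + (real n + 1) * (real n + 2) / 2 * u \<tau> x ^ n * u\<^sub>x \<tau> x
        = real n * (real n - 1) / 2 * u \<tau> x ^ (n - 2) * u\<^sub>x \<tau> x ^ 3
          + 2 * real n * u \<tau> x ^ (n - 1) * u\<^sub>x \<tau> x * u\<^sub>x\<^sub>x \<tau> x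
          + u \<tau> x ^ n * u\<^sub>x\<^sub>x\<^sub>x \<tau> x"
    and ux_bd: "bounded_fun {s..t} u\<^sub>x"
    and uxx_bd: "bounded_fun {s..t} u\<^sub>x\<^sub>x"
    and ut_bd: "bounded_fun {s..t} u\<^sub>t"
    and utx_bd: "bounded_fun {s..t} u\<^sub>t\<^sub>x"
    and u_lim: "\<And>\<tau>. \<tau> \<in> {s..t} \<Longrightarrow> (u \<tau> \<longlongrightarrow> 0) at_infinity"
begin

section \<open>Bounds and decay of the solution\<close>

lemmas cont = u_cont ux_cont uxx_cont ut_cont utx_cont

text \<open>At time \<open>s\<close> the solution is continuous and vanishes at infinity, hence is
  bounded. The bound \<open>M\<close> on \<open>u\<^sub>t\<close> lets it move by at most
  \<open>M * (t - s)\<close> up to any other time.\<close>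

lemma u_bd: "bounded_fun {s..t} u"
proof -
  obtain M where M: "\<And>\<tau> x. \<tau> \<in> {s..t} \<Longrightarrow> \<bar>u\<^sub>t \<tau> x\<bar> \<le> M"
    using ut_bd by (rule bounded_funE) blast
  have "eventually (\<lambda>x. dist (u s x) 0 < 1) at_infinity"
    using tendstoD[OF u_lim[of s]] st by simp
  then obtain B where B: "\<And>x. B \<le> \<bar>x\<bar> \<Longrightarrow> \<bar>u s x\<bar> < 1"
    by (auto simp: eventually_at_infinity)
  have "continuous_on {- B..B} (u s)"
    using DERIV_continuous_on[of "{- B..B}" "u s" "u\<^sub>x s"] ux[of s] st
      has_field_derivative_at_within by fastforce
  then have "bounded (u s ` {- B..B})"
    using compact_continuous_image compact_imp_bounded by blast
  then obtain C where C: "\<forall>x\<in>{- B..B}. \<bar>u s x\<bar> \<le> C"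
    unfolding bounded_iff by auto
  \<comment> \<open>Outside radius \<open>B\<close> the decay gives the bound 1, inside it
    compactness gives \<open>C\<close>.\<close>
  have us: "\<bar>u s x\<bar> \<le> max C 1" for x
  proof (cases "B \<le> \<bar>x\<bar>")
    case True
    then show ?thesis
      using B[of x] by simp
  next
    case False
    then show ?thesis
      using C by (auto simp: abs_if le_max_iff_disj split: if_splits)
  qed
  have "\<bar>u \<tau> x\<bar> \<le> max C 1 + M * (t - s)" if \<tau>: "\<tau> \<in> {s..t}" for \<tau> x
  proof -
    have "norm (u \<tau> x - u s x) \<le> M * norm (\<tau> - s)"
    proof (rule differentiable_bound[of "{s..t}" "\<lambda>\<sigma>. u \<sigma> x" "\<lambda>\<sigma> h. h *\<^sub>R u\<^sub>t \<sigma> x"])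
      show "((\<lambda>\<sigma>. u \<sigma> x) has_derivative (\<lambda>h. h *\<^sub>R u\<^sub>t \<sigma> x)) (at \<sigma> within {s..t})"
        if "\<sigma> \<in> {s..t}" for \<sigma>
        using ut[OF that] by (simp add: has_vector_derivative_def)
      show "onorm (\<lambda>h. h *\<^sub>R u\<^sub>t \<sigma> x) \<le> M" if "\<sigma> \<in> {s..t}" for \<sigma>
        using M[OF that, of x]
        by (intro onorm_bound) (auto simp: abs_mult mult.commute[of M] intro: mult_left_mono)
    qed (use \<tau> st in auto)
    also have "\<dots> \<le> M * (t - s)"
      using \<tau> M[OF \<tau>, of 0] by (intro mult_left_mono) auto
    finally show ?thesis
      using us[of x] by simp
  qed
  then show ?thesis
    unfolding bounded_fun_iff by blast
qed

lemmas bd = u_bd ux_bd uxx_bd ut_bd utx_bd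

lemma ux_lim: "(u\<^sub>x \<tau> \<longlongrightarrow> 0) at_infinity" if "\<tau> \<in> {s..t}"
proof -
  obtain M where "\<And>\<tau> x. \<tau> \<in> {s..t} \<Longrightarrow> \<bar>u\<^sub>x\<^sub>x \<tau> x\<bar> \<le> M"
    using uxx_bd by (rule bounded_funE) blast
  then show ?thesis
    using deriv_tendsto_0_at_infinity[OF ux uxx _ u_lim] that by blast
qed

lemma uxt:
  assumes "\<tau> \<in> {s..t}"
  shows "((\<lambda>\<sigma>. u\<^sub>x \<sigma> x) has_vector_derivative u\<^sub>t\<^sub>x \<tau> x) (at \<tau> within {s..t})"
  by (rule mixed_derivative[OF ux ut utx _ _ assms])
    (use cont in \<open>auto simp: jointly_continuous_def\<close>)

lemma bounded_lim_0:
  assumes "\<tau> \<in> {s..t}" "(f \<longlongrightarrow> 0) at_infinity" "bounded_fun {s..t} g"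
  shows "((\<lambda>x. f x * g \<tau> x) \<longlongrightarrow> 0) at_infinity"
proof -
  obtain C where "\<And>\<tau> x. \<tau> \<in> {s..t} \<Longrightarrow> \<bar>g \<tau> x\<bar> \<le> C"
    using assms(3) by (rule bounded_funE) blast
  then show ?thesis
    using mult_bounded_tendsto_0 assms(1,2) by blast
qed

text \<open>The restriction on \<open>k\<close> excludes the constant
  \<open>u ^ 0 = 1\<close>.\<close>

lemma power_lim_0:
  assumes "\<tau> \<in> {s..t}" "k \<ge> 1"
  shows "((\<lambda>x. u \<tau> x ^ k) \<longlongrightarrow> 0) at_infinity"
  using tendsto_power[OF u_lim[OF assms(1)], of k] assms(2) by (simp add: power_0_left)

lemma power_mult_ux_lim_0:
  assumes "\<tau> \<in> {s..t}"
  shows "((\<lambda>x. u \<tau> x ^ k * (u\<^sub>x \<tau> x)\<^sup>2) \<longlongrightarrow> 0) at_infinity"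
  using tendsto_mult[OF tendsto_power[OF u_lim[OF assms], of k]
      tendsto_power[OF ux_lim[OF assms], of 2]] by simp

text \<open>The mass flux without its term \<open>u\<^sub>t\<^sub>x\<close>, which is not known to
  vanish at infinity and is treated separately.\<close>

definition flux\<^sub>1 :: "real \<Rightarrow> real \<Rightarrow> real" where
  "flux\<^sub>1 \<tau> x = u \<tau> x ^ n * u\<^sub>x\<^sub>x \<tau> x + real n / 2 * (u \<tau> x ^ (n - 1) * (u\<^sub>x \<tau> x)\<^sup>2)
    - (real n + 2) / 2 * u \<tau> x ^ (n + 1)"

text \<open>The whole energy flux: here \<open>u\<^sub>t\<^sub>x\<close> carries the factor
  \<open>u\<close>, so the product vanishes at infinity.\<close>

definition flux\<^sub>2 :: "real \<Rightarrow> real \<Rightarrow> real" where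
  "flux\<^sub>2 \<tau> x = u \<tau> x * u\<^sub>t\<^sub>x \<tau> x + u \<tau> x ^ (n + 1) * u\<^sub>x\<^sub>x \<tau> x
    + (real n - 1) / 2 * (u \<tau> x ^ n * (u\<^sub>x \<tau> x)\<^sup>2) - (real n + 1) / 2 * u \<tau> x ^ (n + 2)"

text \<open>The first claim is the equation itself, the second is the equation times
  \<open>u\<close>, where \<open>u\<^sub>x * u\<^sub>t\<^sub>x\<close> comes from the product rule
  for \<open>u * u\<^sub>t\<^sub>x\<close>. By \<open>uxt\<close> the second derivative is the time
  derivative of the energy density.\<close>

lemma flux_deriv:
  assumes \<tau>: "\<tau> \<in> {s..t}"
  shows "((\<lambda>x. u\<^sub>t\<^sub>x \<tau> x + flux\<^sub>1 \<tau> x) has_real_derivative u\<^sub>t \<tau> x) (at x)"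
    and "(flux\<^sub>2 \<tau> has_real_derivative u \<tau> x * u\<^sub>t \<tau> x + u\<^sub>x \<tau> x * u\<^sub>t\<^sub>x \<tau> x) (at x)"
proof -
  obtain k where k: "n = Suc k"
    using n by (cases n) auto
  \<comment> \<open>Naming the powers with exponents \<open>n - 1\<close> and \<open>n - 2\<close>
    makes both identities polynomial. For \<open>k = 0\<close> truncation gives
    \<open>b = 1\<close>, which only occurs multiplied by \<open>c = 0\<close>.\<close>
  define a b c where abc: "a = u \<tau> x ^ k" "b = u \<tau> x ^ (k - 1)" "c = real k"
  have eq: "u\<^sub>t \<tau> x = u\<^sub>t\<^sub>x\<^sub>x \<tau> x - (c + 2) * (c + 3) / 2 * (u \<tau> x * a) * u\<^sub>x \<tau> x + (c + 1) * c / 2 * b * u\<^sub>x \<tau> x ^ 3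
      + 2 * (c + 1) * a * u\<^sub>x \<tau> x * u\<^sub>x\<^sub>x \<tau> x + u \<tau> x * a * u\<^sub>x\<^sub>x\<^sub>x \<tau> x"
    using pde[OF \<tau>, of x] by (simp add: k abc add.commute)
  \<comment> \<open>Multiplying the equation by \<open>u\<close> produces \<open>u * b\<close> where
    the flux derivative has \<open>a\<close>. The factor \<open>c\<close> matters: for
    \<open>k = 0\<close> these are \<open>u\<close> and 1.\<close>
  have pow: "c * a = c * (u \<tau> x * b)"
    by (cases k) (auto simp: abc)
  note [derivative_intros] = ux[OF \<tau>] uxx[OF \<tau>] uxxx[OF \<tau>] utx[OF \<tau>] utxx[OF \<tau>]
  show "((\<lambda>x. u\<^sub>t\<^sub>x \<tau> x + flux\<^sub>1 \<tau> x) has_real_derivative u\<^sub>t \<tau> x) (at x)"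
  proof (rule DERIV_cong)
    show "((\<lambda>x. u\<^sub>t\<^sub>x \<tau> x + flux\<^sub>1 \<tau> x) has_real_derivative
        u\<^sub>t\<^sub>x\<^sub>x \<tau> x + ((c + 1) * a * u\<^sub>x \<tau> x * u\<^sub>x\<^sub>x \<tau> x + u \<tau> x * a * u\<^sub>x\<^sub>x\<^sub>x \<tau> x
          + (c + 1) / 2 * (c * b * u\<^sub>x \<tau> x * (u\<^sub>x \<tau> x)\<^sup>2 + a * (2 * u\<^sub>x \<tau> x * u\<^sub>x\<^sub>x \<tau> x))
          - (c + 3) / 2 * ((c + 2) * (u \<tau> x * a) * u\<^sub>x \<tau> x))) (at x)"
      unfolding flux\<^sub>1_def unfolding k
      by (rule derivative_eq_intros refl)+ (simp add: abc algebra_simps)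
  qed (use eq in algebra)
  show "(flux\<^sub>2 \<tau> has_real_derivative u \<tau> x * u\<^sub>t \<tau> x + u\<^sub>x \<tau> x * u\<^sub>t\<^sub>x \<tau> x) (at x)"
  proof (rule DERIV_cong)
    show "(flux\<^sub>2 \<tau> has_real_derivative
        u\<^sub>x \<tau> x * u\<^sub>t\<^sub>x \<tau> x + u \<tau> x * u\<^sub>t\<^sub>x\<^sub>x \<tau> x + ((c + 2) * (u \<tau> x * a) * u\<^sub>x \<tau> x * u\<^sub>x\<^sub>x \<tau> x + u \<tau> x * (u \<tau> x * a) * u\<^sub>x\<^sub>x\<^sub>x \<tau> x)
          + c / 2 * ((c + 1) * a * u\<^sub>x \<tau> x * (u\<^sub>x \<tau> x)\<^sup>2 + (u \<tau> x * a) * (2 * u\<^sub>x \<tau> x * u\<^sub>x\<^sub>x \<tau> x))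
          - (c + 2) / 2 * ((c + 3) * (u \<tau> x * (u \<tau> x * a)) * u\<^sub>x \<tau> x)) (at x)"
      unfolding flux\<^sub>2_def[abs_def] unfolding k
      by (rule derivative_eq_intros refl)+ (simp add: abc algebra_simps)
  qed (use eq pow in algebra)
qed

section \<open>Continuity, boundedness and decay of the fluxes\<close>

lemma flux\<^sub>1_cont: "jointly_continuous {s..t} flux\<^sub>1"
  using cont unfolding flux\<^sub>1_def jointly_continuous_def split_def
  by (intro continuous_intros) auto

lemma flux\<^sub>2_cont: "jointly_continuous {s..t} flux\<^sub>2"
  using cont unfolding flux\<^sub>2_def jointly_continuous_def split_def
  by (intro continuous_intros) auto

lemma flux\<^sub>1_bd: "bounded_fun {s..t} flux\<^sub>1"
  unfolding flux\<^sub>1_def by (intro bounded_fun_intros bd)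

lemma flux\<^sub>2_bd: "bounded_fun {s..t} flux\<^sub>2"
  unfolding flux\<^sub>2_def by (intro bounded_fun_intros bd)

lemma flux\<^sub>1_lim:
  assumes "\<tau> \<in> {s..t}"
  shows "(flux\<^sub>1 \<tau> \<longlongrightarrow> 0) at_infinity"
proof -
  have "(flux\<^sub>1 \<tau> \<longlongrightarrow> 0 + real n / 2 * 0 - (real n + 2) / 2 * 0) at_infinity"
    unfolding flux\<^sub>1_def using assms n
    by (intro tendsto_add tendsto_diff tendsto_mult_left bounded_lim_0 power_lim_0
        power_mult_ux_lim_0 bd) auto
  then show ?thesis
    by simp
qed

lemma flux\<^sub>2_lim:
  assumes "\<tau> \<in> {s..t}"
  shows "(flux\<^sub>2 \<tau> \<longlongrightarrow> 0) at_infinity"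
proof -
  have "(flux\<^sub>2 \<tau> \<longlongrightarrow> 0 + 0 + (real n - 1) / 2 * 0 - (real n + 1) / 2 * 0) at_infinity"
    unfolding flux\<^sub>2_def using assms
    by (intro tendsto_add tendsto_diff tendsto_mult_left bounded_lim_0 power_lim_0
        power_mult_ux_lim_0 bd u_lim) auto
  then show ?thesis
    by simp
qed

section \<open>Mass and energy at two times\<close>

lemma integral_flux_lim:
  assumes "jointly_continuous {s..t} g" "bounded_fun {s..t} g"
    "\<And>\<tau>. \<tau> \<in> {s..t} \<Longrightarrow> (g \<tau> \<longlongrightarrow> 0) at_infinity"
  shows "((\<lambda>x. integral {s..t} (\<lambda>\<tau>. g \<tau> x)) \<longlongrightarrow> 0) at_infinity"
proof -
  obtain C where "\<And>\<tau> x. \<tau> \<in> {s..t} \<Longrightarrow> \<bar>g \<tau> x\<bar> \<le> C"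
    using assms(2) by (rule bounded_funE) blast
  then show ?thesis
    by (rule integral_tendsto_0_at_infinity[OF assms(1)[unfolded jointly_continuous_def] _ assms(3)])
qed

lemma integrable_section:
  assumes "jointly_continuous {s..t} g"
  shows "(\<lambda>\<tau>. g \<tau> x) integrable_on {s..t}"
  by (rule integrable_continuous_real[OF
        continuous_on_section[OF assms[unfolded jointly_continuous_def]]])

lemma mass_difference: "((\<lambda>x. u t x - u s x) has_integral 0) UNIV"
proof (rule conservation_law[OF st ut flux_deriv(1)])
  show "continuous_on ({s..t} \<times> UNIV) (\<lambda>(\<tau>, x). u\<^sub>t \<tau> x)"
    using ut_cont by (simp add: jointly_continuous_def)
  show "(\<lambda>\<tau>. u\<^sub>t\<^sub>x \<tau> x + flux\<^sub>1 \<tau> x) integrable_on {s..t}" for x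
    by (intro integrable_add integrable_section utx_cont flux\<^sub>1_cont)
  \<comment> \<open>By \<open>uxt\<close> the time integral of \<open>u\<^sub>t\<^sub>x\<close>
    collapses to values of \<open>u\<^sub>x\<close> at \<open>t\<close> and \<open>s\<close>, which
    decay by \<open>ux_lim\<close>.\<close>
  have "integral {s..t} (\<lambda>\<tau>. u\<^sub>t\<^sub>x \<tau> x + flux\<^sub>1 \<tau> x) =
      u\<^sub>x t x - u\<^sub>x s x + integral {s..t} (\<lambda>\<tau>. flux\<^sub>1 \<tau> x)" for x
    using integral_add[OF integrable_section[OF utx_cont] integrable_section[OF flux\<^sub>1_cont], of x x]
      integral_unique[OF fundamental_theorem_of_calculus[OF st uxt, of x]]
    by simp
  moreover have "((\<lambda>x. u\<^sub>x t x - u\<^sub>x s x + integral {s..t} (\<lambda>\<tau>. flux\<^sub>1 \<tau> x)) \<longlongrightarrow> 0 - 0 + 0)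
      at_infinity"
    using st
    by (intro tendsto_intros ux_lim integral_flux_lim flux\<^sub>1_cont flux\<^sub>1_bd flux\<^sub>1_lim) auto
  ultimately show "((\<lambda>x. integral {s..t} (\<lambda>\<tau>. u\<^sub>t\<^sub>x \<tau> x + flux\<^sub>1 \<tau> x)) \<longlongrightarrow> 0) at_infinity"
    by simp
qed auto

text \<open>Unlike the mass flux, the energy flux vanishes at infinity at each fixed time, so
  dominated convergence applies to it directly; \<open>uxt\<close> enters in the time derivative of
  the squared \<open>u\<^sub>x\<close>.\<close>

lemma energy_difference:
  "((\<lambda>x. ((u t x)\<^sup>2 + (u\<^sub>x t x)\<^sup>2) / 2 - ((u s x)\<^sup>2 + (u\<^sub>x s x)\<^sup>2) / 2) has_integral 0) UNIV"
proof (rule conservation_law[OF st _ flux_deriv(2)])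
  show "((\<lambda>\<sigma>. ((u \<sigma> x)\<^sup>2 + (u\<^sub>x \<sigma> x)\<^sup>2) / 2) has_vector_derivative
      u \<tau> x * u\<^sub>t \<tau> x + u\<^sub>x \<tau> x * u\<^sub>t\<^sub>x \<tau> x) (at \<tau> within {s..t})" if "\<tau> \<in> {s..t}" for \<tau> x
    using ut[OF that, of x] uxt[OF that, of x]
    unfolding has_real_derivative_iff_has_vector_derivative[symmetric]
    by (auto intro!: derivative_eq_intros simp: field_simps)
  show "continuous_on ({s..t} \<times> UNIV) (\<lambda>(\<tau>, x). u \<tau> x * u\<^sub>t \<tau> x + u\<^sub>x \<tau> x * u\<^sub>t\<^sub>x \<tau> x)"
    using cont unfolding jointly_continuous_def split_def by (intro continuous_intros) auto
qed (auto intro!: integrable_section integral_flux_lim flux\<^sub>2_cont flux\<^sub>2_bd flux\<^sub>2_lim)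

end

section \<open>Passage to an arbitrary time interval\<close>

lemma solution_imp_decaying_solution:
  assumes "n \<ge> 1" "solution n T u" "s \<le> t" and sub: "{s..t} \<subseteq> T"
    and "\<forall>t\<in>T. (u t \<longlongrightarrow> 0) at_infinity"
    and "\<forall>f \<in> {Dt T u, Dx u, Dx (Dt T u), Dx (Dx u)}. bounded_fun T f"
  shows "decaying_solution n s t u (Dx u) (Dx (Dx u)) (Dx (Dx (Dx u)))
    (Dt T u) (Dx (Dt T u)) (Dx (Dx (Dt T u)))"
proof -
  have reg: "regular T u"
    using assms(2) by (simp add: solution_def)
  \<comment> \<open>\<open>Dx\<close> and \<open>Dt\<close> are total operators; the existence
    statements in \<open>regular\<close> make their values genuine derivatives.\<close>
  have Dx: "(v \<tau> has_real_derivative Dx v \<tau> x) (at x)"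
    if "has_Dx T v" "\<tau> \<in> {s..t}" for v \<tau> x
    using that sub unfolding has_Dx_def Dx_def
    by (auto simp: DERIV_deriv_iff_field_differentiable)
  \<comment> \<open>A derivative within \<open>T\<close> restricts to the smaller interval, becoming
    one-sided at \<open>s\<close> and \<open>t\<close> even where these are interior to
    \<open>T\<close>.\<close>
  have Dt: "((\<lambda>\<sigma>. u \<sigma> x) has_vector_derivative Dt T u \<tau> x) (at \<tau> within {s..t})"
    if "\<tau> \<in> {s..t}" for \<tau> x
    using that sub reg unfolding regular_def has_Dt_def Dt_def
    by (meson has_vector_derivative_within_subset subsetD vector_derivative_works)
  have cont: "jointly_continuous {s..t} f" if "jointly_continuous T f" for f
    using that sub unfolding jointly_continuous_def
    by (rule continuous_on_subset[OF _ Sigma_mono]) auto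
  have bd: "bounded_fun {s..t} f" if "bounded_fun T f" for f
    using that sub unfolding bounded_fun_iff by blast
  show ?thesis
  proof
    show "Dt T u \<tau> x - Dx (Dx (Dt T u)) \<tau> x
          + (real n + 1) * (real n + 2) / 2 * u \<tau> x ^ n * Dx u \<tau> x
        = real n * (real n - 1) / 2 * u \<tau> x ^ (n - 2) * Dx u \<tau> x ^ 3
          + 2 * real n * u \<tau> x ^ (n - 1) * Dx u \<tau> x * Dx (Dx u) \<tau> x
          + u \<tau> x ^ n * Dx (Dx (Dx u)) \<tau> x" if "\<tau> \<in> {s..t}" for \<tau> x
      using assms(2) that sub unfolding solution_def by blast
    show "(u \<tau> \<longlongrightarrow> 0) at_infinity" if "\<tau> \<in> {s..t}" for \<tau>
      using assms(5) that sub by blast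
  qed (use assms(1,3,6) reg in \<open>simp_all add: regular_def Dx Dt cont bd\<close>)
qed

theorem corollary2p1:
  fixes n :: nat and T :: "real set" and u :: "real \<Rightarrow> real \<Rightarrow> real"
  assumes "n \<ge> 1"
    and "is_interval T"
    and "solution n T u"
    and "\<forall>t\<in>T. (u t \<longlongrightarrow> 0) at_infinity"
    and "\<forall>f \<in> {Dt T u, Dx u, Dx (Dt T u), Dx (Dx u)}. bounded_fun T f"
  shows "((\<lambda>t. u t integrable_on UNIV) constant_on T \<and> mass u constant_on T) \<and>
         ((\<lambda>t. energy_density u t integrable_on UNIV) constant_on T \<and> energy u constant_on T) \<and>
         (\<forall>t\<in>T. energy u t = 1 / 2 * (H1_norm (u t))\<^sup>2) \<and>
         ((\<forall>t\<in>T. \<forall>x. u t x \<ge> 0) \<or> (\<forall>t\<in>T. \<forall>x. u t x \<le> 0) \<longrightarrow>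
           (\<lambda>t. L1_norm (u t)) constant_on T)"
proof -
  have diff: "((\<lambda>x. u t x - u s x) has_integral 0) UNIV"
      "((\<lambda>x. energy_density u t x - energy_density u s x) has_integral 0) UNIV"
    if "s \<in> T" "t \<in> T" "s \<le> t" for s t
  proof -
    have "{s..t} \<subseteq> T"
      by (auto intro: mem_is_interval_1_I[OF assms(2) that(1,2)])
    then interpret decaying_solution n s t u "Dx u" "Dx (Dx u)" "Dx (Dx (Dx u))"
      "Dt T u" "Dx (Dt T u)" "Dx (Dx (Dt T u))"
      using solution_imp_decaying_solution assms that by blast
    show "((\<lambda>x. u t x - u s x) has_integral 0) UNIV"
      by (rule mass_difference)
    show "((\<lambda>x. energy_density u t x - energy_density u s x) has_integral 0) UNIV"
      using energy_difference by (simp add: energy_density_def)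
  qed
  have mass: "(\<lambda>t. u t integrable_on UNIV) constant_on T" "mass u constant_on T"
    using integral_constant_on[of T u, OF diff(1)] unfolding mass_def[abs_def] by auto
  moreover have "(\<lambda>t. energy_density u t integrable_on UNIV) constant_on T" "energy u constant_on T"
    using integral_constant_on[of T "energy_density u", OF diff(2)]
    unfolding energy_def[abs_def] by auto
  moreover have "energy u t = 1 / 2 * (H1_norm (u t))\<^sup>2" for t
  proof -
    \<comment> \<open>Nonnegativity lets the square cancel the square root. Without integrability
      the integral is 0 by default, so the identity holds at every time.\<close>
    have "integral UNIV (\<lambda>x. (u t x)\<^sup>2 + (deriv (u t) x)\<^sup>2) \<ge> 0"
      by (cases "(\<lambda>x. (u t x)\<^sup>2 + (deriv (u t) x)\<^sup>2) integrable_on UNIV")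
        (auto intro: integral_nonneg simp: not_integrable_integral)
    then show ?thesis
      by (simp add: energy_def energy_density_def H1_norm_def Dx_def)
  qed
  moreover have "(\<lambda>t. L1_norm (u t)) constant_on T"
    if "(\<forall>t\<in>T. \<forall>x. u t x \<ge> 0) \<or> (\<forall>t\<in>T. \<forall>x. u t x \<le> 0)"
  proof -
    \<comment> \<open>The sign is the same at all times in \<open>T\<close>, so the norm is
      \<open>mass\<close> throughout or its negative throughout.\<close>
    have "L1_norm (u t) = mass u t" if "\<forall>x. u t x \<ge> 0" for t
      using that by (simp add: L1_norm_def mass_def)
    moreover have "L1_norm (u t) = - mass u t" if "\<forall>x. u t x \<le> 0" for t
      using that by (simp add: L1_norm_def mass_def abs_of_nonpos)
    ultimately show ?thesis
      using that mass(2) unfolding constant_on_def by metis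
  qed
  ultimately show ?thesis
    by blast
qed

end
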